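(* Let $G$ be a chordal bipartite graph with $\kappa(G)=k$, where $k\ge 1$. Let $uv$ be a bisimplicial edge of $G$. Then $\kappa(G\ominus uv)\ge k-1$.
   Context: All graphs are finite and simple. A graph is bipartite if its vertex set can be partitioned into two independent sets. A bipartite graph is called chordal bipartite if every cycle of length at least six has a chord, where a chord of a cycle $C$ is an edge not in $E(C)$ both of whose end-vertices lie on $C$. $N_G(v)$ denotes the set of vertices adjacent to $v$ in $G$. An edge $uv$ of a bipartite graph $G$ is bisimplicial if $N_G(u)\cup N_G(v)$ induces in $G$ a complete bipartite graph with bipartition $(N_G(u),N_G(v))$, i.e. every vertex of $N_G(u)$ is adjacent to every vertex of $N_G(v)$. For an edge $uv$ of $G$, $G\ominus uv$ denotes $G-\{u,v\}$, the graph obtained from $G$ by deleting the vertices $u$ and $v$ together with all edges incident with them. A vertex cut of $G$ is a set $S\subseteq V(G)$ such that $G-S$ is disconnected (so $S=\emptyset$ is a vertex cut when $G$ is disconnected). The connectivity $\kappa(G)$ is the minimum size of a vertex cut if $G$ is not complete, and $|V(G)|-1$ if $G$ is complete. *)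

theory Defs
  imports "Graph_Theory.Digraph_Component" "Graph_Theory.Kuratowski"
begin

text \<open>
  Finite simple graphs are the digraphs satisfying the library locale \<^locale>\<open>graph\<close>: finite,
  symmetric, without loops and without parallel arcs. An undirected edge \<open>xy\<close> is the pair of
  opposite arcs joining \<open>x\<close> and \<open>y\<close>, and adjacency is \<open>x \<rightarrow>\<^bsub>G\<^esub> y\<close>.
\<close>

definition neighborhood :: "('a, 'b) pre_digraph \<Rightarrow> 'a \<Rightarrow> 'a set" where
  "neighborhood G v = {w \<in> verts G. v \<rightarrow>\<^bsub>G\<^esub> w}"

definition independent_set :: "('a, 'b) pre_digraph \<Rightarrow> 'a set \<Rightarrow> bool" where
  "independent_set G S \<longleftrightarrow> S \<subseteq> verts G \<and> (\<forall>x\<in>S. \<forall>y\<in>S. \<not> x \<rightarrow>\<^bsub>G\<^esub> y)"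

definition bipartite :: "('a, 'b) pre_digraph \<Rightarrow> bool" where
  "bipartite G \<longleftrightarrow>
    (\<exists>A B. A \<union> B = verts G \<and> A \<inter> B = {} \<and> independent_set G A \<and> independent_set G B)"

text \<open>
  A library cycle is a list of arcs. Its edges are taken undirected here, so that the arc opposite
  to an arc of the cycle does not count as a chord. The library also admits a cycle of length two
  that runs back and forth along one edge; this is harmless below, where only cycles of length at
  least six matter.
\<close>

definition cycle_edges :: "('a, 'b) pre_digraph \<Rightarrow> 'b awalk \<Rightarrow> 'a set set" where
  "cycle_edges G p = (\<lambda>e. {tail G e, head G e}) ` set p"

definition chord :: "('a, 'b) pre_digraph \<Rightarrow> 'b awalk \<Rightarrow> 'a \<Rightarrow> 'a \<Rightarrow> bool" where
  "chord G p x y \<longleftrightarrow> x \<rightarrow>\<^bsub>G\<^esub> y \<and> {x, y} \<notin> cycle_edges G p \<and>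
    x \<in> \<Union> (cycle_edges G p) \<and> y \<in> \<Union> (cycle_edges G p)"

definition chordal_bipartite :: "('a, 'b) pre_digraph \<Rightarrow> bool" where
  "chordal_bipartite G \<longleftrightarrow> bipartite G \<and>
    (\<forall>p. pre_digraph.cycle G p \<and> 6 \<le> length p \<longrightarrow> (\<exists>x y. chord G p x y))"

definition complete_bipartite_with :: "('a, 'b) pre_digraph \<Rightarrow> 'a set \<Rightarrow> 'a set \<Rightarrow> bool" where
  "complete_bipartite_with G A B \<longleftrightarrow>
    verts G = A \<union> B \<and> A \<inter> B = {} \<and> arcs_ends G = A \<times> B \<union> B \<times> A"

definition bisimplicial :: "('a, 'b) pre_digraph \<Rightarrow> 'a \<Rightarrow> 'a \<Rightarrow> bool" where
  "bisimplicial G u v \<longleftrightarrow> u \<rightarrow>\<^bsub>G\<^esub> v \<and>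
    complete_bipartite_with (G \<restriction> (neighborhood G u \<union> neighborhood G v))
      (neighborhood G u) (neighborhood G v)"

definition delete_verts :: "('a, 'b) pre_digraph \<Rightarrow> 'a set \<Rightarrow> ('a, 'b) pre_digraph" where
  "delete_verts G S = G \<restriction> (verts G - S)"

definition ominus_edge :: "('a, 'b) pre_digraph \<Rightarrow> 'a \<Rightarrow> 'a \<Rightarrow> ('a, 'b) pre_digraph" where
  "ominus_edge G u v = delete_verts G {u, v}"

text \<open>
  The library counts the graph without vertices as not connected, so the whole vertex set is a
  vertex cut as well. This does not affect the minimum size: in a graph that is not complete,
  deleting all vertices but two nonadjacent ones gives a smaller cut.
\<close>

definition vertex_cut :: "('a, 'b) pre_digraph \<Rightarrow> 'a set \<Rightarrow> bool" where
  "vertex_cut G S \<longleftrightarrow> S \<subseteq> verts G \<and> \<not> Digraph_Component.connected (delete_verts G S)"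

definition complete :: "('a, 'b) pre_digraph \<Rightarrow> bool" where
  "complete G \<longleftrightarrow> complete_digraph (card (verts G)) G"

text \<open>
  The subtraction is truncated: the graph without vertices, which arises when both vertices of
  the complete graph on two vertices are deleted, has connectivity 0.
\<close>

definition connectivity :: "('a, 'b) pre_digraph \<Rightarrow> nat" where
  "connectivity G =
    (if complete G then card (verts G) - 1
     else (LEAST n. \<exists>S. vertex_cut G S \<and> card S = n))"

end

theory Submission
  imports Defs
begin

text \<open>
  Let \<open>S\<close> be a vertex cut of \<open>G \<ominus> uv\<close> with fewer than \<open>k - 1\<close> elements that leaves a set \<open>X\<close>
  separated from a set \<open>Y\<close>. Neither \<open>S \<union> {u}\<close> nor \<open>S \<union> {v}\<close> is a vertex cut of \<open>G\<close>, so \<open>u\<close> has a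
  neighbour in \<open>X\<close> and \<open>v\<close> has a neighbour in \<open>Y\<close>. These two are adjacent because \<open>uv\<close> is
  bisimplicial, a contradiction. A cut that leaves no vertex at all is too large, since a graph
  that is not complete has \<open>\<kappa>(G) \<le> |V(G)| - 2\<close>. If \<open>G\<close> is
  complete, a third vertex would be a common neighbour of \<open>u\<close> and \<open>v\<close>, so \<open>k = 1\<close>.
\<close>

lemma dominates_induce_subgraph_iff:
  "x \<rightarrow>\<^bsub>G \<restriction> T\<^esub> y \<longleftrightarrow> x \<rightarrow>\<^bsub>G\<^esub> y \<and> x \<in> T \<and> y \<in> T"
  by (auto simp: arcs_ends_conv)

lemma verts_delete_verts [simp]: "verts (delete_verts G S) = verts G - S"
  by (simp add: delete_verts_def)

lemma dominates_delete_verts_iff: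
  "x \<rightarrow>\<^bsub>delete_verts G S\<^esub> y \<longleftrightarrow> x \<rightarrow>\<^bsub>G\<^esub> y \<and> x \<in> verts G - S \<and> y \<in> verts G - S"
  by (simp add: delete_verts_def dominates_induce_subgraph_iff)

lemma graph_delete_verts:
  assumes "graph G"
  shows "graph (delete_verts G S)"
proof -
  interpret graph G by fact
  show ?thesis
  proof
    show "symmetric (delete_verts G S)"
      using graph_symmetric
      by (auto simp: symmetric_def sym_def dominates_delete_verts_iff)
  next
    fix e\<^sub>1 e\<^sub>2
    assume "e\<^sub>1 \<in> arcs (delete_verts G S)" "e\<^sub>2 \<in> arcs (delete_verts G S)"
      "arc_to_ends (delete_verts G S) e\<^sub>1 = arc_to_ends (delete_verts G S) e\<^sub>2"
    then show "e\<^sub>1 = e\<^sub>2"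
      using no_multi_arcs by (auto simp: delete_verts_def arc_to_ends_def)
  qed (auto simp: delete_verts_def no_loops)
qed

text \<open>Arcs come in opposite pairs, so the symmetric closure adds nothing and
  \<open>connected\<close> means strongly connected. A walk leaving \<open>X\<close> must cross its
  boundary; conversely, the set of vertices reachable from \<open>a\<close> has no outgoing
  arc.\<close>

lemma connected_iff_crossing:
  assumes "graph G"
  shows "Digraph_Component.connected G \<longleftrightarrow> verts G \<noteq> {} \<and>
    (\<forall>X. X \<noteq> {} \<and> X \<subset> verts G \<longrightarrow> (\<exists>x\<in>X. \<exists>y\<in>verts G - X. x \<rightarrow>\<^bsub>G\<^esub> y))"
    (is "?conn \<longleftrightarrow> ?crossing")
proof -
  interpret graph G by fact
  have "symcl (arcs_ends G) = arcs_ends G"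
    using graph_symmetric by (auto simp: symcl_def)
  then have conn: "?conn \<longleftrightarrow> strongly_connected G"
    by (simp add: connected_conv strongly_connected_def reachable_def)
  show ?thesis
  proof
    assume ?conn
    then have sc: "strongly_connected G" by (simp add: conn)
    have "\<exists>x\<in>X. \<exists>y\<in>verts G - X. x \<rightarrow>\<^bsub>G\<^esub> y" if X: "X \<noteq> {}" "X \<subset> verts G" for X
    proof (rule ccontr)
      assume no: "\<not> ?thesis"
      from X obtain a b where ab: "a \<in> X" "b \<in> verts G - X" by blast
      with sc X have "a \<rightarrow>\<^sup>*\<^bsub>G\<^esub> b" by (auto simp: strongly_connected_def)
      then have "b \<in> X"
        by (induction rule: reachable_induct) (use ab no adj_in_verts in blast)+
      with ab show False by blast
    qed
    with sc show ?crossing by (auto simp: strongly_connected_def)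
  next
    assume cr: ?crossing
    have "a \<rightarrow>\<^sup>*\<^bsub>G\<^esub> b" if ab: "a \<in> verts G" "b \<in> verts G" for a b
    proof (rule ccontr)
      assume "\<not> ?thesis"
      define R where "R = {c. a \<rightarrow>\<^sup>*\<^bsub>G\<^esub> c}"
      have "R \<subseteq> verts G" by (auto simp: R_def elim: reachable_in_vertsE)
      moreover have "a \<in> R" "b \<notin> R" using ab \<open>\<not> _\<close> by (simp_all add: R_def)
      ultimately have "R \<noteq> {} \<and> R \<subset> verts G" using ab by blast
      with cr have "\<exists>x\<in>R. \<exists>y\<in>verts G - R. x \<rightarrow>\<^bsub>G\<^esub> y" by simp
      then obtain x y where "a \<rightarrow>\<^sup>*\<^bsub>G\<^esub> x" "\<not> a \<rightarrow>\<^sup>*\<^bsub>G\<^esub> y" "x \<rightarrow>\<^bsub>G\<^esub> y"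
        by (auto simp: R_def)
      then show False using reachable_adj_trans by blast
    qed
    with cr show ?conn by (auto simp: conn strongly_connected_def)
  qed
qed

text \<open>This form exposes the two sides of a cut, which the main argument works with. The
  disjunct \<open>S = verts G\<close> is the degenerate case of an empty remainder and has to be
  excluded by counting later.\<close>

lemma vertex_cut_iff_separation:
  assumes "graph G"
  shows "vertex_cut G S \<longleftrightarrow> S \<subseteq> verts G \<and>
    (S = verts G \<or> (\<exists>X. X \<noteq> {} \<and> X \<subset> verts G - S \<and>
      (\<forall>x\<in>X. \<forall>y\<in>verts G - S - X. \<not> x \<rightarrow>\<^bsub>G\<^esub> y)))"
proof -
  let ?D = "delete_verts G S"
  have "(\<exists>x\<in>X. \<exists>y\<in>verts ?D - X. x \<rightarrow>\<^bsub>?D\<^esub> y) \<longleftrightarrow>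
      \<not> (\<forall>x\<in>X. \<forall>y\<in>verts G - S - X. \<not> x \<rightarrow>\<^bsub>G\<^esub> y)" if "X \<subset> verts G - S" for X
    using that by (auto simp: dominates_delete_verts_iff)
  then have "Digraph_Component.connected ?D \<longleftrightarrow> verts G - S \<noteq> {} \<and>
      \<not> (\<exists>X. X \<noteq> {} \<and> X \<subset> verts G - S \<and> (\<forall>x\<in>X. \<forall>y\<in>verts G - S - X. \<not> x \<rightarrow>\<^bsub>G\<^esub> y))"
    unfolding connected_iff_crossing[OF graph_delete_verts[OF assms]] verts_delete_verts by metis
  moreover have "S \<subseteq> verts G \<and> verts G - S = {} \<longleftrightarrow> S = verts G" by blast
  ultimately show ?thesis unfolding vertex_cut_def by metis
qed

text \<open>\<open>complete\<close> passes the graph's own order to \<open>complete_digraph\<close>,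
  so the cardinality condition there is trivial; absence of loops gives the converse inclusion of
  arcs.\<close>

lemma complete_iff:
  assumes "graph G"
  shows "complete G \<longleftrightarrow> (\<forall>x\<in>verts G. \<forall>y\<in>verts G. x \<noteq> y \<longrightarrow> x \<rightarrow>\<^bsub>G\<^esub> y)"
proof -
  interpret graph G by fact
  have "x \<in> verts G \<and> y \<in> verts G \<and> x \<noteq> y" if "x \<rightarrow>\<^bsub>G\<^esub> y" for x y
    using that adj_in_verts[OF that] adj_not_same by metis
  moreover have "complete G \<longleftrightarrow>
      (\<forall>x y. x \<rightarrow>\<^bsub>G\<^esub> y \<longleftrightarrow> x \<in> verts G \<and> y \<in> verts G \<and> x \<noteq> y)"
    unfolding complete_def complete_digraph_def set_eq_iff split_paired_All
    by (simp only: assms mem_Collect_eq case_prod_conv mem_Times_iff fst_conv snd_conv simp_thms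
        conj_assoc)
  ultimately show ?thesis by metis
qed

lemma connectivity_le_card_cut:
  assumes "\<not> complete G" "vertex_cut G S"
  shows "connectivity G \<le> card S"
  using assms by (auto simp: connectivity_def intro: Least_le)

lemma connectivity_attained:
  assumes "graph G" "\<not> complete G"
  obtains S where "vertex_cut G S" "card S = connectivity G"
proof -
  \<comment> \<open>The degenerate cut shows that \<open>LEAST\<close> ranges over a nonempty set of
    sizes.\<close>
  have "vertex_cut G (verts G)"
    by (simp add: vertex_cut_iff_separation[OF assms(1)])
  then have "\<exists>n S. vertex_cut G S \<and> card S = n" by blast
  from LeastI_ex[OF this] show ?thesis
    using assms(2) that by (auto simp: connectivity_def)
qed

text \<open>All vertices except two nonadjacent ones form a cut. The gap of 2 matches the two
  vertices removed by \<open>ominus_edge\<close>.\<close>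

lemma connectivity_incomplete_le:
  assumes "graph G" "\<not> complete G"
  shows "connectivity G + 2 \<le> card (verts G)"
proof -
  interpret graph G by fact
  obtain x y where xy: "x \<in> verts G" "y \<in> verts G" "x \<noteq> y" "\<not> x \<rightarrow>\<^bsub>G\<^esub> y"
    using assms by (auto simp: complete_iff)
  have "{x} \<noteq> {} \<and> {x} \<subset> verts G - (verts G - {x, y}) \<and>
      (\<forall>a\<in>{x}. \<forall>b\<in>verts G - (verts G - {x, y}) - {x}. \<not> a \<rightarrow>\<^bsub>G\<^esub> b)"
    using xy by auto
  then have "vertex_cut G (verts G - {x, y})"
    unfolding vertex_cut_iff_separation[OF assms(1)] by blast
  then have "connectivity G \<le> card (verts G - {x, y})"
    using assms(2) by (rule connectivity_le_card_cut[rotated])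
  also have "\<dots> = card (verts G) - 2"
    using xy by (simp add: card_Diff_subset)
  finally have "connectivity G \<le> card (verts G) - 2" .
  \<comment> \<open>Subtraction is truncated, so the order must be known to be at least 2.\<close>
  moreover have "card {x, y} \<le> card (verts G)"
    using xy by (intro card_mono) auto
  ultimately show ?thesis using xy by simp
qed

lemma bisimplicialD:
  assumes "graph G" "bisimplicial G u v"
  shows "u \<rightarrow>\<^bsub>G\<^esub> v"
    and "\<And>x y. u \<rightarrow>\<^bsub>G\<^esub> x \<Longrightarrow> v \<rightarrow>\<^bsub>G\<^esub> y \<Longrightarrow> x \<rightarrow>\<^bsub>G\<^esub> y"
    and "\<And>x. u \<rightarrow>\<^bsub>G\<^esub> x \<Longrightarrow> \<not> v \<rightarrow>\<^bsub>G\<^esub> x"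
proof -
  interpret graph G by fact
  show "u \<rightarrow>\<^bsub>G\<^esub> v" using assms(2) unfolding bisimplicial_def by (rule conjunct1)
  show "x \<rightarrow>\<^bsub>G\<^esub> y" if "u \<rightarrow>\<^bsub>G\<^esub> x" "v \<rightarrow>\<^bsub>G\<^esub> y" for x y
  proof -
    have "x \<in> neighborhood G u" "y \<in> neighborhood G v"
      using that adj_in_verts by (auto simp: neighborhood_def)
    then have "x \<rightarrow>\<^bsub>G \<restriction> (neighborhood G u \<union> neighborhood G v)\<^esub> y"
      using assms(2) by (simp add: bisimplicial_def complete_bipartite_with_def)
    then show ?thesis by (simp add: dominates_induce_subgraph_iff)
  qed
  \<comment> \<open>A common neighbour \<open>x\<close> would be adjacent to itself by the previous
    fact, giving a loop.\<close>
  then show "\<not> v \<rightarrow>\<^bsub>G\<^esub> x" if "u \<rightarrow>\<^bsub>G\<^esub> x" for x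
    using that adj_not_same by blast
qed

text \<open>If \<open>u\<close> had no neighbour in \<open>X\<close>, it could join the side of
  \<open>Y\<close>, and \<open>insert w S\<close> would be a cut of \<open>G\<close> smaller than
  the connectivity. The roles of \<open>u\<close>, \<open>w\<close> and of \<open>X\<close>,
  \<open>Y\<close> are left open so that the lemma serves both ends of the edge.\<close>

lemma neighbour_in_separated_side:
  assumes G: "graph G" and incomplete: "\<not> complete G"
    and S: "S \<subseteq> verts G" "card S + 1 < connectivity G"
    and w: "w \<in> verts G"
    and X: "X \<noteq> {}" and Y: "Y \<noteq> {}" and "X \<inter> Y = {}"
    and parts: "X \<union> Y = verts G - {u, w} - S"
    and sep: "\<And>x y. x \<in> X \<Longrightarrow> y \<in> Y \<Longrightarrow> \<not> x \<rightarrow>\<^bsub>G\<^esub> y"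
  shows "\<exists>x\<in>X. x \<rightarrow>\<^bsub>G\<^esub> u"
proof (rule ccontr)
  assume "\<not> ?thesis"
  then have no: "\<not> x \<rightarrow>\<^bsub>G\<^esub> u" if "x \<in> X" for x using that by blast
  have "vertex_cut G (insert w S)"
    unfolding vertex_cut_iff_separation[OF G]
  proof (intro conjI disjI2 exI[of _ X] ballI)
    fix x y assume "x \<in> X" "y \<in> verts G - insert w S - X"
    then show "\<not> x \<rightarrow>\<^bsub>G\<^esub> y" using parts no sep by blast
  qed (use assms in blast)+
  then have "connectivity G \<le> card (insert w S)"
    by (rule connectivity_le_card_cut[OF incomplete])
  also have "\<dots> \<le> card S + 1" by (rule card_insert_le_m1) simp_all
  finally show False using S by simp
qed

theorem lemma2p5:
  fixes G :: "('a, 'b) pre_digraph" and u v :: 'a and k :: nat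
  assumes "graph G"
    and "chordal_bipartite G"
    and "connectivity G = k"
    and "k \<ge> 1"
    and "bisimplicial G u v"
  shows "connectivity (ominus_edge G u v) \<ge> k - 1"
proof -
  interpret graph G by fact
  let ?H = "ominus_edge G u v"
  note bis = bisimplicialD[OF assms(1,5)]
  have H: "graph ?H"
    unfolding ominus_edge_def by (rule graph_delete_verts) fact
  have vH [simp]: "verts ?H = verts G - {u, v}"
    by (simp add: ominus_edge_def)
  have uv: "u \<in> verts G" "v \<in> verts G" "u \<noteq> v"
    using adj_in_verts[OF bis(1)] bis(1) adj_not_same by metis+
  have card_vH: "card (verts ?H) = card (verts G) - 2"
    using uv by (simp add: card_Diff_subset)
  show ?thesis
  proof (cases "complete G")
    case True
    then have adj: "x \<rightarrow>\<^bsub>G\<^esub> y" if "x \<in> verts G" "y \<in> verts G" "x \<noteq> y" for x y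
      using that by (simp add: complete_iff[OF assms(1)])
    \<comment> \<open>A third vertex would be a common neighbour of \<open>u\<close> and
      \<open>v\<close>.\<close>
    have "w = u \<or> w = v" if "w \<in> verts G" for w
      using adj[OF uv(1) that] adj[OF uv(2) that] bis(3) by blast
    then have "verts G = {u, v}" using uv by auto
    then have "k = 1" using True uv assms(3) by (simp add: connectivity_def)
    then show ?thesis by simp
  next
    case incomplete: False
    have k: "k + 2 \<le> card (verts G)"
      using connectivity_incomplete_le[OF assms(1) incomplete] assms(3) by simp
    show ?thesis
    proof (cases "complete ?H")
      case True
      \<comment> \<open>Here the connectivity of \<open>?H\<close> is
        \<open>card (verts G) - 3\<close>, which \<open>k\<close> bounds below by
        \<open>k - 1\<close>.\<close>
      then show ?thesis using k card_vH by (simp add: connectivity_def)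
    next
      case False
      then obtain S where S: "vertex_cut ?H S" "card S = connectivity ?H"
        using H connectivity_attained by blast
      show ?thesis
      proof (rule ccontr)
        assume "\<not> ?thesis"
        then have small: "card S + 1 < connectivity G" using S(2) assms(3) by simp
        \<comment> \<open>The whole of \<open>verts ?H\<close> has \<open>card (verts G) - 2\<close>
          elements, hence at least \<open>k\<close>.\<close>
        then have "S \<noteq> verts ?H" using k card_vH assms(3) by auto
        then obtain X where SV: "S \<subseteq> verts ?H" and X: "X \<noteq> {}" "X \<subset> verts ?H - S"
          and sep_H: "\<forall>x\<in>X. \<forall>y\<in>verts ?H - S - X. \<not> x \<rightarrow>\<^bsub>?H\<^esub> y"
          using S(1) unfolding vertex_cut_iff_separation[OF H] by blast
        define Y where "Y = verts ?H - S - X"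
        have SG: "S \<subseteq> verts G" using SV by auto
        have Y: "Y \<noteq> {}" "X \<inter> Y = {}" using X by (auto simp: Y_def)
        have parts: "X \<union> Y = verts G - {u, v} - S" using X by (auto simp: Y_def)
        have sep: "\<not> x \<rightarrow>\<^bsub>G\<^esub> y" if "x \<in> X" "y \<in> Y" for x y
          using that sep_H X(2)
          by (auto simp: Y_def ominus_edge_def dominates_delete_verts_iff)
        \<comment> \<open>The set that fails to be a cut here is \<open>insert v S\<close>.\<close>
        obtain x where x: "x \<in> X" "x \<rightarrow>\<^bsub>G\<^esub> u"
          using neighbour_in_separated_side[OF assms(1) incomplete SG small uv(2) X(1) Y parts]
            sep by blast
        \<comment> \<open>The same lemma with both pairs exchanged, now for
          \<open>insert u S\<close>; symmetry of adjacency turns the separation around.\<close>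
        have "\<exists>y\<in>Y. y \<rightarrow>\<^bsub>G\<^esub> v"
        proof (rule neighbour_in_separated_side
            [OF assms(1) incomplete SG small uv(1) Y(1) X(1)])
          show "Y \<inter> X = {}" using Y(2) by blast
          show "Y \<union> X = verts G - {v, u} - S" using parts by blast
          show "\<not> a \<rightarrow>\<^bsub>G\<^esub> b" if "a \<in> Y" "b \<in> X" for a b
            using that sep graph_symmetric by blast
        qed
        then obtain y where y: "y \<in> Y" "y \<rightarrow>\<^bsub>G\<^esub> v" by blast
        have "x \<rightarrow>\<^bsub>G\<^esub> y"
          using bis(2) x(2) y(2) graph_symmetric by blast
        then show False using sep x(1) y(1) by blast
      qed
    qed
  qed
qed

end
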